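(* Fix an integer $n \ge 2$. For an integer $H \ge 1$, let $\mathcal{D}_n(H)$ denote the number of Dumas polynomials $f(x)=\sum_{i=0}^n A_i x^i\in\mathbb{Z}[x]$ of degree $n$ (so $A_n\neq 0$) with height $\max\{|A_0|,\dots,|A_n|\}\le H$. Then, as $H\to\infty$, $$\mathcal{D}_n(H) \le (2H)^{n+1}\tau_n + \begin{cases} O\big(H^2 (\log H)^2\big), & \text{if } n=2;\\ O\big(H^n\big), & \text{if } n\ge 3,\end{cases}$$ where $$\tau_n=\begin{cases} 1-\prod_{p\ \text{prime}}\left(1-\frac{1}{p}\right)^2\left(1+\frac{2}{p}\right), & \text{if } n=2;\\ 1-\frac{1}{\zeta(n-1)}, & \text{if } n\ge 3,\end{cases}$$ and $\zeta$ is the Riemann zeta function. (The implied constants in the $O$-terms may depend on $n$.)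
   Context: Newton diagram: let $p$ be a prime and $f(x)=\sum_{i=0}^n A_i x^i\in\mathbb{Z}[x]$ with $A_0A_n\neq 0$. For each nonzero coefficient write $A_i = a_i p^{\alpha_i}$ with $\gcd(a_i,p)=1$ (so $\alpha_i$ is the $p$-adic valuation of $A_i$), and plot the point $(i,\alpha_i)$. Let $P_0=(0,\alpha_0)$; given $P_k=(i_k,\alpha_{i_k})$ with $i_k<n$, let $P_{k+1}=(i_{k+1},\alpha_{i_{k+1}})$ where $i_{k+1}$ is the largest index for which no plotted point lies strictly below the line $P_kP_{k+1}$; continue until reaching $P_r=(n,\alpha_n)$ (this is the lower convex hull of the plotted points). Any points with integer coordinates lying on the segments of the broken line $P_0\cdots P_r$ are also declared vertices; the resulting broken line $Q_0\cdots Q_{r+s}$ is the Newton diagram of $f$ with respect to $p$, and its segments are the segments $Q_jQ_{j+1}$. A polynomial $f\in\mathbb{Z}[x]$ with nonzero leading coefficient and nonzero constant term is called a Dumas polynomial if for some prime $p$ its Newton diagram with respect to $p$ consists of precisely one segment, i.e. a single segment from $(0,\alpha_0)$ to $(n,\alpha_n)$ containing no integer-coordinate points other than its endpoints (Dumas's criterion then guarantees irreducibility). The height of $f$ is $H(f)=\max_i |A_i|$. The notation $U=O(V)$ means $|U|\le c|V|$ for some constant $c>0$. *)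

theory Defs
  imports
    "HOL-Analysis.Analysis"
    "HOL-Computational_Algebra.Computational_Algebra"
    "HOL-Library.Landau_Symbols"
begin

text \<open>Heights and Newton diagrams of integer polynomials. Indices with vanishing coefficient
  have no plotted point, so the definitions below only use \<open>newton_point p f i\<close> for
  \<open>coeff f i \<noteq> 0\<close>.\<close>

definition height :: "int poly \<Rightarrow> int" where
  "height f = Max ((\<lambda>i. \<bar>coeff f i\<bar>) ` {..degree f})"

definition newton_point :: "nat \<Rightarrow> int poly \<Rightarrow> nat \<Rightarrow> real \<times> real" where
  "newton_point p f i = (real i, real (multiplicity (int p) (coeff f i)))"

text \<open>\<open>R\<close> lies strictly below the line through \<open>P\<close> and \<open>Q\<close>, for \<open>fst P \<noteq> fst Q\<close>.\<close>

definition strictly_below_line ::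
    "real \<times> real \<Rightarrow> real \<times> real \<Rightarrow> real \<times> real \<Rightarrow> bool" where
  "strictly_below_line P Q R \<longleftrightarrow>
     snd R < snd P + (snd Q - snd P) / (fst Q - fst P) * (fst R - fst P)"

text \<open>If \<open>i < degree f\<close> is the index of a corner, then a largest \<open>j\<close> as required exists: it is the
  last index attaining the minimal slope from \<open>i\<close> to the plotted points on its right.\<close>

definition newton_next :: "nat \<Rightarrow> int poly \<Rightarrow> nat \<Rightarrow> nat" where
  "newton_next p f i = (GREATEST j. i < j \<and> coeff f j \<noteq> 0 \<and>
     (\<forall>k. coeff f k \<noteq> 0 \<longrightarrow>
        \<not> strictly_below_line (newton_point p f i) (newton_point p f j) (newton_point p f k)))"

inductive_set newton_corners :: "nat \<Rightarrow> int poly \<Rightarrow> nat set"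
  for p :: nat and f :: "int poly" where
  start: "0 \<in> newton_corners p f"
| step: "i \<in> newton_corners p f \<Longrightarrow> i < degree f \<Longrightarrow> newton_next p f i \<in> newton_corners p f"

definition newton_broken_line :: "nat \<Rightarrow> int poly \<Rightarrow> (real \<times> real) set" where
  "newton_broken_line p f =
     (\<Union>i\<in>{i \<in> newton_corners p f. i < degree f}.
        closed_segment (newton_point p f i) (newton_point p f (newton_next p f i)))"

text \<open>The corners and all further integer points of the broken line.\<close>

definition newton_vertices :: "nat \<Rightarrow> int poly \<Rightarrow> (real \<times> real) set" where
  "newton_vertices p f = newton_broken_line p f \<inter> \<int> \<times> \<int>"

text \<open>The broken line is the graph of a function of the first coordinate, so consecutive vertices
  are those with no vertex strictly between them in the first coordinate.\<close>

definition newton_segments :: "nat \<Rightarrow> int poly \<Rightarrow> (real \<times> real) set set" where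
  "newton_segments p f =
     {closed_segment Q R | Q R. Q \<in> newton_vertices p f \<and> R \<in> newton_vertices p f \<and>
        fst Q < fst R \<and> \<not> (\<exists>S \<in> newton_vertices p f. fst Q < fst S \<and> fst S < fst R)}"

definition dumas_poly :: "int poly \<Rightarrow> bool" where
  "dumas_poly f \<longleftrightarrow> lead_coeff f \<noteq> 0 \<and> coeff f 0 \<noteq> 0 \<and>
     (\<exists>p::nat. prime p \<and> card (newton_segments p f) = 1)"

definition dumas_count :: "nat \<Rightarrow> nat \<Rightarrow> nat" where
  "dumas_count n H = card {f :: int poly. degree f = n \<and> dumas_poly f \<and> height f \<le> int H}"

text \<open>The Riemann zeta function on the half-line \<open>s > 1\<close>, where its Dirichlet series converges;
  the values for other \<open>s\<close> are meaningless.\<close>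

definition zeta :: "real \<Rightarrow> real" where
  "zeta s = (\<Sum>m. 1 / real (Suc m) powr s)"

definition tau :: "nat \<Rightarrow> real" where
  "tau n =
     (if n = 2 then
        1 - (\<Prod>p::nat. if prime p then (1 - 1 / real p)\<^sup>2 * (1 + 2 / real p) else 1)
      else 1 - 1 / zeta (real n - 1))"

end

(*
The main term has room to spare. A one-segment diagram forces a prime p to divide all of
A_1, ..., A_(n-1) and in addition A_0 or A_n, which has probability 2/p^n - 1/p^(n+1), whereas
tau_n only accounts for p dividing all of A_1, ..., A_(n-1) (n >= 3), respectively at least two of
the three coefficients (n = 2). It therefore suffices to count tuples without zero coordinates
crudely: p = 2 exactly, with density 3/2^(n+1), and all odd divisors m >= 3 by the union bound.
For n >= 3 the total is below tau_n already. For n = 2 the plain union bound slightly exceeds tau_2,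
but outside the tuples counted for p = 2 the density for odd m drops by the factor 5/8, and this
suffices. The error term O(H^n) comes from the tuples
with a zero coordinate and, for n = 2, from rounding in the parity counts.
*)
theory Submission imports Defs begin

subsection \<open>Newton diagrams with a single segment\<close>

abbreviation next_cond :: "nat \<Rightarrow> int poly \<Rightarrow> nat \<Rightarrow> nat \<Rightarrow> bool" where
  "next_cond p f i j \<equiv> i < j \<and> coeff f j \<noteq> 0 \<and>
     (\<forall>k. coeff f k \<noteq> 0 \<longrightarrow>
        \<not> strictly_below_line (newton_point p f i) (newton_point p f j) (newton_point p f k))"

text \<open>\<open>GREATEST\<close> is informative only if some index qualifies and all are bounded;
  a minimiser of the slope from \<open>i\<close> qualifies, and the degree is a bound. Since
  \<open>strictly_below_line\<close> uses the whole line, plotted points left of \<open>i\<close>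
  matter too. The hypothesis \<open>left\<close>, convexity at \<open>i\<close>, controls them and
  is vacuous for \<open>i = 0\<close>.\<close>

lemma newton_next_greatest:
  assumes "i < degree f"
    and left: "\<And>k l. k < i \<Longrightarrow> i < l \<Longrightarrow> coeff f k \<noteq> 0 \<Longrightarrow> coeff f l \<noteq> 0 \<Longrightarrow>
      (snd (newton_point p f i) - snd (newton_point p f k)) / (real i - real k)
      \<le> (snd (newton_point p f l) - snd (newton_point p f i)) / (real l - real i)"
  shows "next_cond p f i (newton_next p f i)"
    and "\<And>j. next_cond p f i j \<Longrightarrow> j \<le> newton_next p f i"
proof -
  define a where "a k = snd (newton_point p f k)" for k
  define sl where "sl l = (a l - a i) / (real l - real i)" for l
  define J where "J = {k. i < k \<and> coeff f k \<noteq> 0}"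
  have fin: "finite J"
    by (rule finite_subset[of _ "{..degree f}"]) (auto simp: J_def intro: le_degree)
  have "degree f \<in> J" using assms(1) by (auto simp: J_def)
  then have ne: "J \<noteq> {}" by auto
  obtain j where j: "j \<in> J" "\<And>k. k \<in> J \<Longrightarrow> sl j \<le> sl k"
    using arg_min_if_finite[OF fin ne, of sl] by (metis not_le)
  have ij: "i < j" using j by (auto simp: J_def)
  have above: "a k \<ge> a i + sl j * (real k - real i)" if "coeff f k \<noteq> 0" for k
  proof (cases k i rule: linorder_cases)
    case less
    have "(a i - a k) / (real i - real k) \<le> sl j"
      using left[OF less ij that] j(1) by (auto simp: J_def a_def sl_def)
    then show ?thesis using less by (simp add: field_simps)
  next
    case greater
    then have "sl j \<le> (a k - a i) / (real k - real i)" using j(2)[of k] that by (auto simp: J_def sl_def)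
    then show ?thesis using greater by (simp add: field_simps)
  qed simp
  have "next_cond p f i j"
    using ij j(1) above
    by (auto simp: J_def strictly_below_line_def a_def sl_def newton_point_def not_less)
  moreover have bound: "\<forall>k. next_cond p f i k \<longrightarrow> k \<le> degree f"
    by (auto intro: le_degree)
  ultimately show "next_cond p f i (newton_next p f i)"
    unfolding newton_next_def
    using GreatestI_nat[where P = "next_cond p f i" and k = j and b = "degree f"] by fast
  show "k \<le> newton_next p f i" if "next_cond p f i k" for k
    unfolding newton_next_def
    using Greatest_le_nat[where P = "next_cond p f i" and k = k and b = "degree f"] that bound by fast
qed

text \<open>Joining \<open>Q\<close> to a nearest vertex on each side gives two segments. Nearest
  vertices exist because first coordinates of vertices are integers.\<close>

lemma card_segments_ne_1:
  assumes "P \<in> newton_vertices p f" "Q \<in> newton_vertices p f" "R \<in> newton_vertices p f"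
    and "fst P < fst Q" "fst Q < fst R"
  shows "card (newton_segments p f) \<noteq> 1"
proof
  assume "card (newton_segments p f) = 1"
  then obtain s where s: "newton_segments p f = {s}" by (auto simp: card_1_singleton_iff)
  let ?V = "newton_vertices p f"
  have ints: "fst v \<in> \<int>" if "v \<in> ?V" for v
    using that by (auto simp: newton_vertices_def)
  have finI: "finite {x \<in> \<int>. a \<le> x \<and> x \<le> b}" for a b :: real
  proof (rule finite_subset)
    show "{x \<in> \<int>. a \<le> x \<and> x \<le> b} \<subseteq> real_of_int ` {\<lfloor>a\<rfloor>..\<lceil>b\<rceil>}"
      by (auto elim!: Ints_cases simp: image_iff le_ceiling_iff floor_le_iff)
  qed simp
  define A where "A = fst ` {v \<in> ?V. fst P \<le> fst v \<and> fst v < fst Q}"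
  have fA: "finite A"
    by (rule finite_subset[OF _ finI[of "fst P" "fst Q"]]) (auto simp: A_def dest: ints)
  have neA: "A \<noteq> {}" using assms(1,4) unfolding A_def by blast
  obtain P' where P': "P' \<in> ?V" "fst P' < fst Q" "fst P' = Max A" "fst P \<le> fst P'"
    using Max_in[OF fA neA] by (auto simp: A_def)
  have "\<not> (\<exists>S \<in> ?V. fst P' < fst S \<and> fst S < fst Q)"
  proof
    assume "\<exists>S \<in> ?V. fst P' < fst S \<and> fst S < fst Q"
    then obtain S where S: "S \<in> ?V" "fst P' < fst S" "fst S < fst Q" by auto
    then have "fst S \<in> A" using P' by (auto simp: A_def)
    then show False using Max_ge[OF fA, of "fst S"] S P' by simp
  qed
  then have 1: "closed_segment P' Q \<in> newton_segments p f"
    using P' assms(2) unfolding newton_segments_def by blast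
  define B where "B = fst ` {v \<in> ?V. fst Q < fst v \<and> fst v \<le> fst R}"
  have fB: "finite B"
    by (rule finite_subset[OF _ finI[of "fst Q" "fst R"]]) (auto simp: B_def dest: ints)
  have neB: "B \<noteq> {}" using assms(3,5) unfolding B_def by blast
  obtain R' where R': "R' \<in> ?V" "fst Q < fst R'" "fst R' = Min B" "fst R' \<le> fst R"
    using Min_in[OF fB neB] by (auto simp: B_def)
  have "\<not> (\<exists>S \<in> ?V. fst Q < fst S \<and> fst S < fst R')"
  proof
    assume "\<exists>S \<in> ?V. fst Q < fst S \<and> fst S < fst R'"
    then obtain S where S: "S \<in> ?V" "fst Q < fst S" "fst S < fst R'" by auto
    then have "fst S \<in> B" using R' by (auto simp: B_def)
    then show False using Min_le[OF fB, of "fst S"] S R' by simp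
  qed
  then have 2: "closed_segment Q R' \<in> newton_segments p f"
    using R' assms(2) unfolding newton_segments_def by blast
  \<comment> \<open>With only one segment, \<open>P'\<close> would lie on the segment from
    \<open>Q\<close> to \<open>R'\<close>, all of whose points have first coordinate at least
    \<open>fst Q\<close>.\<close>
  have "P' \<in> closed_segment Q R'" using 1 2 s by (metis ends_in_segment(1) singletonD)
  then obtain u where "0 \<le> u" "P' = (1 - u) *\<^sub>R Q + u *\<^sub>R R'" by (auto simp: in_segment)
  then have "fst P' = (1 - u) * fst Q + u * fst R'" by simp
  then have "fst P' = fst Q + u * (fst R' - fst Q)" by (simp add: algebra_simps)
  then show False using \<open>0 \<le> u\<close> R' P'
    by (smt (verit, ccfv_SIG) mult_nonneg_nonneg)
qed

lemma newton_point_in_vertices: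
  assumes "i \<in> newton_corners p f" "i < degree f"
  shows "newton_point p f i \<in> newton_vertices p f"
    and "newton_point p f (newton_next p f i) \<in> newton_vertices p f"
  using assms by (auto simp: newton_vertices_def newton_broken_line_def newton_point_def)

text \<open>A single segment must run from index 0 to the degree and cannot be horizontal. Its ends
  have nonnegative heights, not both zero, so it is strictly positive between them, and the plotted
  points lie on or above it.\<close>

lemma dumas_poly_imp_common_prime:
  assumes d: "dumas_poly f" and n: "degree f \<ge> 2"
  obtains p where "prime p" "\<And>i. 0 < i \<Longrightarrow> i < degree f \<Longrightarrow> int p dvd coeff f i"
    "int p dvd coeff f 0 \<or> int p dvd coeff f (degree f)"
proof -
  obtain p where p: "prime p" "card (newton_segments p f) = 1" and f0: "coeff f 0 \<noteq> 0"
    using d by (auto simp: dumas_poly_def)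
  let ?n = "degree f"
  define a where "a k = snd (newton_point p f k)" for k
  have np: "newton_point p f k = (real k, a k)" for k by (simp add: a_def newton_point_def)
  define c where "c = newton_next p f 0"
  have c: "next_cond p f 0 c" "\<And>j. next_cond p f 0 j \<Longrightarrow> j \<le> c"
    using newton_next_greatest[of 0 f p] n by (auto simp: c_def)
  have cn: "c \<le> ?n" using c by (auto intro: le_degree)
  have corner: "0 \<in> newton_corners p f" "c \<in> newton_corners p f"
    using newton_corners.step[OF newton_corners.start, of f p] n by (auto simp: c_def intro: newton_corners.start)
  have above: "a k \<ge> a 0 + (a c - a 0) / real c * real k" if "coeff f k \<noteq> 0" for k
    using c(1) that by (auto simp: strictly_below_line_def np)
  have "c = ?n"
  proof (rule ccontr)
    assume "c \<noteq> ?n"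
    then have lt: "c < ?n" using cn by simp
    \<comment> \<open>Another corner step from \<open>c\<close> would give a third vertex, to the
      right of those at 0 and \<open>c\<close>.\<close>
    have "next_cond p f c (newton_next p f c)"
    proof (rule newton_next_greatest(1)[OF lt], goal_cases)
      case (1 k l)
      \<comment> \<open>All plotted points lie on or above the line of slope \<open>m\<close>
        through the points at 0 and \<open>c\<close>. So chords ending at \<open>c\<close> have
        slope at most \<open>m\<close> and chords starting there have slope at least
        \<open>m\<close>, which is the required convexity at \<open>c\<close>.\<close>
      define m where "m = (a c - a 0) / real c"
      have c0: "c > 0" using c(1) by simp
      have ac: "a c = a 0 + m * real c" using c0 by (simp add: m_def)
      have "a l > a 0 + m * real l"
      proof (rule ccontr)
        assume "\<not> a l > a 0 + m * real l"
        then have "a l = a 0 + m * real l" using above[OF 1(4)] by (simp add: m_def)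
        then have "(a l - a 0) / real l = (a c - a 0) / real c"
          using 1 c0 by (simp flip: m_def)
        then have "next_cond p f 0 l" using above 1 c0
          by (simp add: strictly_below_line_def np not_less)
        then have "l \<le> c" by (rule c(2))
        then show False using 1 by simp
      qed
      moreover have "a k \<ge> a 0 + m * real k" using above[OF 1(3)] by (simp add: m_def)
      ultimately have "(a c - a k) / (real c - real k) \<le> m" "m \<le> (a l - a c) / (real l - real c)"
        using 1 by (simp_all add: ac field_simps)
      then show ?case by (simp add: a_def)
    qed
    then have "c < newton_next p f c" by blast
    moreover have "0 < c" using c(1) by blast
    ultimately show False
      using card_segments_ne_1[OF newton_point_in_vertices(1)[OF corner(1)]
          newton_point_in_vertices(1)[OF corner(2) lt] newton_point_in_vertices(2)[OF corner(2) lt]]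
        p(2) lt by (simp add: np)
  qed
  have ends: "newton_point p f 0 \<in> newton_vertices p f" "newton_point p f ?n \<in> newton_vertices p f"
    using newton_point_in_vertices[OF corner(1)] n \<open>c = ?n\<close> by (auto simp: c_def)
  \<comment> \<open>A horizontal segment would contain the integer point \<open>(1, a 0)\<close>,
    which is interior because the degree is at least 2.\<close>
  have "a 0 \<noteq> a ?n"
  proof
    assume eq: "a 0 = a ?n"
    have "(1, a 0) = (1 - 1 / real ?n) *\<^sub>R newton_point p f 0 + (1 / real ?n) *\<^sub>R newton_point p f ?n"
      using n by (auto simp: np eq algebra_simps)
    then have "(1, a 0) \<in> closed_segment (newton_point p f 0) (newton_point p f ?n)"
      using n unfolding closed_segment_def by (intro CollectI exI[of _ "1 / real ?n"]) auto
    then have "(1, a 0) \<in> newton_vertices p f"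
      using corner(1) n \<open>c = ?n\<close>
      unfolding newton_vertices_def newton_broken_line_def
      by (intro IntI UN_I[of 0]) (auto simp: c_def a_def newton_point_def)
    from card_segments_ne_1[OF ends(1) this ends(2)] show False using p n by (simp add: np)
  qed
  \<comment> \<open>A zero coefficient has no plotted point but is divisible by \<open>p\<close>
    anyway, hence the conditional premise.\<close>
  have dvdI: "int p dvd coeff f i" if "coeff f i \<noteq> 0 \<Longrightarrow> a i > 0" for i
  proof (rule ccontr)
    assume *: "\<not> int p dvd coeff f i"
    then have "coeff f i \<noteq> 0" by auto
    with that have "a i > 0" by blast
    then show False using not_dvd_imp_multiplicity_0[OF *] by (simp add: a_def newton_point_def)
  qed
  have pos: "a i \<ge> 0" for i by (simp add: a_def newton_point_def)
  show thesis
  proof (rule that[OF p(1)])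
    fix i assume i: "0 < i" "i < ?n"
    show "int p dvd coeff f i"
    proof (rule dvdI)
      assume "coeff f i \<noteq> 0"
      then have *: "a i \<ge> a 0 + (a ?n - a 0) / real ?n * real i" using above[of i] unfolding \<open>c = ?n\<close> by blast
      \<comment> \<open>The height of the segment at \<open>i\<close> is an average of the end
        heights with positive weights, so it is positive as soon as one of them is.\<close>
      have lr: "a 0 + (a ?n - a 0) / real ?n * real i =
        (a 0 * (real ?n - real i) + a ?n * real i) / real ?n" (is "?l = ?r") using i by (simp add: field_simps)
      have "a 0 * (real ?n - real i) + a ?n * real i > 0"
      proof (cases "a 0 > 0")
        case True
        then have "a 0 * (real ?n - real i) > 0" using i by simp
        then show ?thesis using pos[of ?n] by (simp add: add_pos_nonneg)
      next
        case False
        then have "a 0 = 0" "a ?n > 0" using \<open>a 0 \<noteq> a ?n\<close> pos[of 0] pos[of ?n] by linarith+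
        then show ?thesis using i by simp
      qed
      then have "?r > 0" using i by (intro divide_pos_pos) auto
      then have "?l > 0" using lr by linarith
      then show "a i > 0" using * by linarith
    qed
  next
    show "int p dvd coeff f 0 \<or> int p dvd coeff f ?n"
    proof (cases "a 0 > 0")
      case False
      then have "a ?n > 0" using \<open>a 0 \<noteq> a ?n\<close> pos[of 0] pos[of ?n] by linarith
      then show ?thesis using dvdI by blast
    qed (use dvdI in blast)
  qed
qed

subsection \<open>Numerical bounds for the main term\<close>

text \<open>Removing the Euler factor at 2 leaves the Dirichlet series over odd integers, whose
  first two terms bound it from below.\<close>

lemma zeta_euler_factor_2:
  assumes s: "s > 1"
  shows "1 + 3 powr -s \<le> (1 - 2 powr -s) * zeta s"
proof -
  define f where "f m = 1 / real (Suc m) powr s" for m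
  have "summable (\<lambda>m. real m powr (-s))" using s by (simp add: summable_real_powr_iff)
  then have "summable f"
    unfolding f_def by (subst (asm) summable_Suc_iff[symmetric]) (simp add: powr_minus_divide)
  then have f: "f sums zeta s" unfolding zeta_def f_def by (rule summable_sums)
  \<comment> \<open>As \<open>f m\<close> belongs to the integer \<open>m + 1\<close>, each block
    pairs the odd integer \<open>2k + 1\<close> with the even integer
    \<open>2(k + 1)\<close>.\<close>
  have "(\<lambda>k. \<Sum>m\<in>{k*2..<k*2+2}. f m) sums zeta s" by (rule sums_group[OF f]) simp
  moreover have "(\<Sum>m\<in>{k*2..<k*2+2}. f m) = f (2*k) + 2 powr -s * f k" for k
  proof -
    have "{k*2..<k*2+2} = {2*k, Suc (2*k)}" by auto
    moreover have "real (Suc (Suc (2*k))) powr s = 2 powr s * real (Suc k) powr s"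
      by (subst powr_mult[symmetric]) (auto simp: algebra_simps)
    ultimately show ?thesis by (simp add: f_def powr_minus_divide)
  qed
  ultimately have "(\<lambda>k. (f (2*k) + 2 powr -s * f k) - 2 powr -s * f k) sums (zeta s - 2 powr -s * zeta s)"
    by (intro sums_diff sums_mult f) simp
  then have g: "(\<lambda>k. f (2*k)) sums ((1 - 2 powr -s) * zeta s)" by (simp add: algebra_simps)
  have "(\<Sum>k<2. f (2*k)) \<le> (\<Sum>k. f (2*k))"
    using g by (intro sum_le_suminf) (auto simp: sums_iff f_def)
  then show ?thesis using g by (simp add: sums_iff f_def numeral_2_eq_2 powr_minus_divide)
qed

lemma tau_ge:
  assumes n: "n \<ge> 3"
  shows "1 - (1 - 1 / 2 ^ (n - 1)) / (1 + 1 / 3 ^ (n - 1)) \<le> tau n"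
proof -
  have pw: "a powr - (real n - 1) = 1 / a ^ (n - 1)" if "a > 0" for a :: real
  proof -
    have "real n - 1 = real (n - 1)" using n by simp
    then show ?thesis using that by (simp only: powr_minus_divide powr_realpow)
  qed
  have z: "1 + 1 / 3 ^ (n - 1) \<le> (1 - 1 / 2 ^ (n - 1)) * zeta (real n - 1)"
    using zeta_euler_factor_2[of "real n - 1"] n by (simp only: pw[of 2] pw[of 3])
  have "1 - 1 / 2 ^ (n - 1) > (0::real)" using n by (simp add: one_less_power)
  moreover have "0 < (1::real) + 1 / 3 ^ (n - 1)" by (simp add: add_pos_pos)
  ultimately have "zeta (real n - 1) > 0" using z by (smt (verit) zero_less_mult_pos)
  then have "1 / zeta (real n - 1) \<le> (1 - 1 / 2 ^ (n - 1)) / (1 + 1 / 3 ^ (n - 1))"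
    using z by (simp add: divide_le_eq le_divide_eq add_pos_pos mult.commute)
  then show ?thesis using n by (simp add: tau_def)
qed

text \<open>All factors lie in (0, 1], so the product is at most its part over 2, 3, 5, 7. Stopping
  at 5 would give only about 0.668, below the density \<open>(3 + 935 / 384) / 8\<close>, about
  0.679, obtained in \<open>dumas_count_2_le\<close>.\<close>

lemma tau_2_ge: "tau 2 \<ge> 343 / 500"
proof -
  define f :: "nat \<Rightarrow> real"
    where "f p = (if prime p then (1 - 1 / real p)\<^sup>2 * (1 + 2 / real p) else 1)" for p
  have f1: "f p = 1 + (if prime p then - 3 / real p ^ 2 + 2 / real p ^ 3 else 0)" for p
    using prime_gt_0_nat[of p] by (auto simp: f_def field_simps power2_eq_square power3_eq_cube)
  have pos: "f p > 0" for p
    using prime_gt_1_nat[of p] by (auto simp: f_def intro!: mult_pos_pos add_pos_pos)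
  have le1: "f p \<le> 1" for p
  proof (cases "prime p")
    case True
    then have "real p \<ge> 1" using prime_gt_0_nat[of p] by simp
    then have "2 / real p ^ 3 \<le> 3 / real p ^ 2"
      by (simp add: field_simps power2_eq_square power3_eq_cube)
    then show ?thesis by (simp add: f1)
  qed (simp add: f_def)
  \<comment> \<open>Absolute convergence, by comparison with \<open>3 / p^2\<close>, makes
    \<open>prodinf f\<close> the limit of its partial products.\<close>
  have "summable (\<lambda>p. norm (f p - 1))"
  proof (rule summable_comparison_test)
    show "summable (\<lambda>p. 3 * (1 / real p ^ 2))"
      using inverse_power_summable[of 2] by (intro summable_mult) (simp add: inverse_eq_divide)
    have "norm (f p - 1) \<le> 3 / real p ^ 2" for p
    proof (cases "prime p")
      case True
      then have "f p - 1 = 2 / real p ^ 3 - 3 / real p ^ 2" by (simp add: f1)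
      moreover have "0 \<le> 2 / real p ^ 3" by simp
      ultimately show ?thesis using le1[of p] by (simp only: real_norm_def)
    qed (simp add: f_def)
    then show "\<exists>N. \<forall>p\<ge>N. norm (norm (f p - 1)) \<le> 3 * (1 / real p ^ 2)" by simp
  qed
  then have conv: "convergent_prod f"
    by (intro abs_convergent_prod_imp_convergent_prod summable_imp_abs_convergent_prod)
  have p: "prime (5::nat)" "prime (7::nat)" "\<not> prime (4::nat)" "\<not> prime (6::nat)"
    by simp_all
  have eq: "{..<8::nat} = {0,1,2,3,4,5,6,7}" by auto
  have 8: "prod f {..<8} \<le> 157 / 500"
    unfolding eq using p by (simp add: f_def field_simps power2_eq_square)
  have "prodinf f \<le> 157 / 500"
  proof (rule prodinf_le_const[OF conv])
    fix n :: nat assume n: "n \<ge> 8"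
    have "prod f {..<n} = prod f {..<8} * prod f {8..<n}"
      using n by (subst prod.union_disjoint[symmetric]) (auto intro: prod.cong)
    also have "\<dots> \<le> prod f {..<8} * 1"
      using pos le1 by (intro mult_left_mono prod_le_1 prod_nonneg) (auto intro: less_imp_le)
    finally show "prod f {..<n} \<le> 157 / 500" using 8 by simp
  qed
  then show ?thesis by (simp add: tau_def f_def[abs_def])
qed

text \<open>The term for 3 is kept exactly. From the others a factor \<open>1 / 5 ^ (n - 2)\<close>
  is taken out, and the remaining inverse squares of odd integers from 5 on sum to at most
  1/8.\<close>

lemma sum_odd_inverse_powers_le:
  assumes "n \<ge> 2"
  shows "(\<Sum>j<N. 1 / real (2 * j + 3) ^ n) \<le> 1 / 3 ^ n + 1 / (8 * 5 ^ (n - 2))"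
proof -
  \<comment> \<open>The bound carries the telescoping remainder so that the induction closes; it is
    an equality at \<open>N = 0\<close>.\<close>
  have "(\<Sum>j<Suc N. 1 / real (2 * j + 3) ^ n)
      \<le> 1 / 3 ^ n + (1 / 2 - 1 / (real N + 2)) / (4 * 5 ^ (n - 2))" for N
  proof (induction N)
    case (Suc N)
    \<comment> \<open>\<open>1 / (2j + 3)\<^sup>2 \<le> 1 / ((2j + 2) (2j + 4))\<close> makes the sum telescope\<close>
    have "(5::real) ^ (n - 2) * (4 * ((real N + 2) * (real N + 3))) \<le> real (2 * Suc N + 3) ^ (n - 2) * real (2 * Suc N + 3) ^ 2"
      by (intro mult_mono power_mono) (auto simp: power2_eq_square algebra_simps)
    also have "\<dots> = real (2 * Suc N + 3) ^ n"
      by (simp only: power_add[symmetric] le_add_diff_inverse2[OF assms])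
    finally have "1 / real (2 * Suc N + 3) ^ n \<le> 1 / (5 ^ (n - 2) * (4 * ((real N + 2) * (real N + 3))))"
      by (intro divide_left_mono mult_pos_pos) auto
    also have "\<dots> = (1 / (real N + 2) - 1 / (real (Suc N) + 2)) / (4 * 5 ^ (n - 2))"
      by (simp add: field_simps)
    finally show ?case using Suc.IH by (simp add: diff_divide_distrib)
  qed simp
  from this[of N] have "(\<Sum>j<Suc N. 1 / real (2 * j + 3) ^ n)
      \<le> 1 / 3 ^ n + (1 / 2) / (4 * 5 ^ (n - 2))"
    by (rule order_trans) (intro add_left_mono divide_right_mono, auto)
  moreover have "(\<Sum>j<N. 1 / real (2 * j + 3) ^ n) \<le> (\<Sum>j<Suc N. 1 / real (2 * j + 3) ^ n)"
    by (intro sum_mono2) auto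
  ultimately show ?thesis by (simp del: sum.lessThan_Suc)
qed

lemma union_bound_le_tau:
  assumes n: "n \<ge> 3"
  shows "3 / 2 ^ (n + 1) + 2 * (1 / 3 ^ n + 1 / (8 * 5 ^ (n - 2))) \<le> tau n"
proof -
  obtain k where k: "n = k + 2" "k \<ge> 1" using that[of "n - 2"] n by simp
  define x y z :: real where "x = 1 / 2 ^ k" and "y = 1 / 3 ^ k" and "z = 1 / 5 ^ k"
  have pos: "x > 0" "y > 0" "z > 0" by (simp_all add: x_def y_def z_def)
  have "(3::real) ^ 1 \<le> 3 ^ k" using k by (intro power_increasing) auto
  then have y3: "y \<le> 1 / 3" by (simp add: y_def field_simps)
  have zx: "z \<le> 2 / 5 * x"
  proof -
    have "z = (2 / 5) ^ k * x" by (simp add: z_def x_def power_divide)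
    moreover have "(2 / 5 :: real) ^ k \<le> (2 / 5) ^ 1" using k by (intro power_decreasing) auto
    ultimately show ?thesis using pos by simp
  qed
  have zy: "z \<le> 3 / 5 * y"
  proof -
    have "z = (3 / 5) ^ k * y" by (simp add: z_def y_def power_divide)
    moreover have "(3 / 5 :: real) ^ k \<le> (3 / 5) ^ 1" using k by (intro power_decreasing) auto
    ultimately show ?thesis using pos by simp
  qed
  \<comment> \<open>Replacing \<open>1 + y / 3\<close> by its upper bound 10/9 makes the inequality
    linear. What remains is \<open>5 * z / 18 <= x / 12 + 7 * y / 81\<close>, which follows from
    \<open>zx\<close> and \<open>zy\<close> together.\<close>
  have "(3 * x / 8 + 2 * (y / 9 + z / 8)) * (1 + y / 3) \<le> (3 * x / 8 + 2 * (y / 9 + z / 8)) * (10 / 9)"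
    using pos y3 by (intro mult_left_mono) auto
  also have "\<dots> \<le> (1 + y / 3) - (1 - x / 2)" using zx zy pos by simp
  finally have "3 * x / 8 + 2 * (y / 9 + z / 8) \<le> 1 - (1 - x / 2) / (1 + y / 3)"
    using pos by (simp add: field_simps)
  moreover have "1 - (1 - x / 2) / (1 + y / 3) \<le> tau n"
    using tau_ge[OF n] by (simp add: k x_def y_def mult.commute)
  ultimately show ?thesis by (simp add: k x_def y_def z_def mult.commute)
qed

subsection \<open>Counting coefficient tuples\<close>

text \<open>Leaving out 0 makes the number of multiples of \<open>m\<close> exactly
  \<open>2 * (H div m)\<close>, at most \<open>2 * H / m\<close>, so the union bound has no rounding
  loss. It also forces a prime dividing an inner coordinate to be at most \<open>H\<close>.\<close>

definition nonzeros :: "nat \<Rightarrow> int set" where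
  "nonzeros H = {x. x \<noteq> 0 \<and> \<bar>x\<bar> \<le> int H}"

definition multiples :: "nat \<Rightarrow> nat \<Rightarrow> int set" where
  "multiples m H = {x \<in> nonzeros H. int m dvd x}"

lemma card_nonzeros: "card (nonzeros H) = 2 * H"
  and finite_nonzeros [simp]: "finite (nonzeros H)"
proof -
  have eq: "nonzeros H = {- int H..-1} \<union> {1..int H}" by (auto simp: nonzeros_def)
  show "finite (nonzeros H)" by (simp add: eq)
  show "card (nonzeros H) = 2 * H"
    unfolding eq by (subst card_Un_disjoint) auto
qed

lemma multiples_eq_image:
  assumes "m > 0"
  shows "multiples m H = (\<lambda>k. int m * k) ` nonzeros (H div m)"
proof -
  have "\<bar>int m * k\<bar> \<le> int H \<longleftrightarrow> \<bar>k\<bar> \<le> int (H div m)" for k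
  proof -
    have "\<bar>int m * k\<bar> \<le> int H \<longleftrightarrow> m * nat \<bar>k\<bar> \<le> H"
      by (simp add: abs_mult nat_abs_mult_distrib flip: of_nat_le_iff[where 'a = int])
    also have "\<dots> \<longleftrightarrow> nat \<bar>k\<bar> \<le> H div m"
      using assms by (simp add: less_eq_div_iff_mult_less_eq mult.commute)
    finally show ?thesis by linarith
  qed
  then show ?thesis using assms by (auto simp: multiples_def nonzeros_def dvd_def)
qed

lemma finite_multiples [simp]: "finite (multiples m H)"
  by (simp add: multiples_def)

lemma inj_on_times_int: "m > 0 \<Longrightarrow> inj_on (\<lambda>k. int m * k) A"
  by (auto simp: inj_on_def)

lemma card_multiples:
  assumes "m > 0"
  shows "card (multiples m H) = 2 * (H div m)"
  by (simp add: multiples_eq_image[OF assms] card_image inj_on_times_int assms card_nonzeros)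

lemma even_nonzeros: "{x \<in> nonzeros H. even x} = multiples 2 H"
  by (simp add: multiples_def)

lemma card_even_nonzeros: "card {x \<in> nonzeros H. even x} = 2 * (H div 2)"
  by (simp add: even_nonzeros card_multiples)

lemma card_odd_nonzeros: "card {x \<in> nonzeros H. odd x} = 2 * H - 2 * (H div 2)"
proof -
  have "{x \<in> nonzeros H. odd x} = nonzeros H - {x \<in> nonzeros H. even x}" by auto
  then show ?thesis by (simp add: card_Diff_subset card_nonzeros card_even_nonzeros subset_iff)
qed

text \<open>Multiplication by an odd \<open>m\<close> preserves parity, so parities can be counted
  among the cofactors.\<close>

lemma card_multiples_parity:
  assumes "odd m"
  shows "card {x \<in> multiples m H. even x} = 2 * (H div m div 2)"
    and "card {x \<in> multiples m H. odd x} = 2 * (H div m) - 2 * (H div m div 2)"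
proof -
  have m: "m > 0" using assms by (cases m) auto
  have "{x \<in> multiples m H. even x} = (\<lambda>k. int m * k) ` {k \<in> nonzeros (H div m). even k}"
    "{x \<in> multiples m H. odd x} = (\<lambda>k. int m * k) ` {k \<in> nonzeros (H div m). odd k}"
    unfolding multiples_eq_image[OF m] using assms by auto
  then show "card {x \<in> multiples m H. even x} = 2 * (H div m div 2)"
    and "card {x \<in> multiples m H. odd x} = 2 * (H div m) - 2 * (H div m div 2)"
    using m by (simp_all add: card_image inj_on_times_int card_even_nonzeros card_odd_nonzeros)
qed

section \<open>Boxes of coefficient tuples and their divisibility conditions\<close>

definition tuple_box :: "nat \<Rightarrow> 'a set \<Rightarrow> 'a set \<Rightarrow> 'a set \<Rightarrow> (nat \<Rightarrow> 'a) set" where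
  "tuple_box n A B C = PiE {..n} (\<lambda>i. if i = 0 then A else if i = n then C else B)"

lemma mem_tuple_box_iff:
  assumes "n > 0"
  shows "x \<in> tuple_box n A B C \<longleftrightarrow>
    x \<in> extensional {..n} \<and> x 0 \<in> A \<and> (\<forall>i. 0 < i \<longrightarrow> i < n \<longrightarrow> x i \<in> B) \<and> x n \<in> C"
  using assms by (auto simp: tuple_box_def PiE_iff le_less split: if_splits)

lemma card_tuple_box:
  assumes "n > 0"
  shows "card (tuple_box n A B C) = card A * card B ^ (n - 1) * card C"
proof -
  have eq: "{..n} = insert 0 (insert n {0<..<n})" using assms by auto
  have "(\<Prod>i\<in>{0<..<n}. card (if i = 0 then A else if i = n then C else B)) = card B ^ (n - 1)"
    by (simp add: prod.cong[where h = "\<lambda>_. card B"])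
  then show ?thesis using assms unfolding tuple_box_def by (subst card_PiE) (simp_all add: eq)
qed

lemma finite_tuple_box: "finite A \<Longrightarrow> finite B \<Longrightarrow> finite C \<Longrightarrow> finite (tuple_box n A B C)"
  unfolding tuple_box_def by (rule finite_PiE) auto

text \<open>For prime \<open>m\<close> this is the divisibility pattern forced by a one-segment
  diagram, on tuples without zero coordinates. Composite \<open>m\<close> is allowed so that the
  union bound can run over all odd integers from 3 on.\<close>

definition edge_div :: "nat \<Rightarrow> nat \<Rightarrow> nat \<Rightarrow> (nat \<Rightarrow> int) set" where
  "edge_div n H m = tuple_box n (multiples m H) (multiples m H) (nonzeros H) \<union>
     tuple_box n (nonzeros H) (multiples m H) (multiples m H)"

lemma finite_edge_div: "finite (edge_div n H m)"
  by (simp add: edge_div_def finite_tuple_box)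

lemma card_edge_div_le:
  assumes "n > 0" "m > 0"
  shows "real (card (edge_div n H m)) \<le> (2 * real H) ^ (n + 1) * (2 / real m ^ n)"
proof -
  define K where "K = H div m"
  have K: "real K \<le> real H / real m" unfolding K_def by (rule of_nat_div_le_of_nat)
  have Kn: "2 * K * (2 * K) ^ (n - 1) = (2 * K) ^ n"
    using assms(1) power_eq_if[of "2 * K" n] by simp
  have "card (edge_div n H m) \<le> card (tuple_box n (multiples m H) (multiples m H) (nonzeros H)) +
      card (tuple_box n (nonzeros H) (multiples m H) (multiples m H))"
    unfolding edge_div_def by (rule card_Un_le)
  also have "\<dots> = 2 * (2 * K * (2 * K) ^ (n - 1) * (2 * H))"
    using assms by (simp add: card_tuple_box card_multiples card_nonzeros K_def)
  finally have "card (edge_div n H m) \<le> 2 * ((2 * K) ^ n * (2 * H))"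
    unfolding Kn .
  then have "real (card (edge_div n H m)) \<le> real (2 * ((2 * K) ^ n * (2 * H)))"
    by (simp only: of_nat_le_iff)
  also have "\<dots> = 2 * ((2 * real K) ^ n * (2 * real H))" by simp
  also have "\<dots> \<le> 2 * ((2 * (real H / real m)) ^ n * (2 * real H))"
    using K by (intro mult_left_mono mult_right_mono power_mono) auto
  also have "\<dots> = (2 * real H) ^ (n + 1) * (2 / real m ^ n)"
    by (simp add: power_mult_distrib power_divide)
  finally show ?thesis .
qed

lemma card_edge_div_2_le:
  assumes "n > 0"
  shows "real (card (edge_div n H 2)) \<le> (2 * real H) ^ (n + 1) * (3 / 2 ^ (n + 1))"
proof -
  let ?N = "nonzeros H" and ?E = "multiples 2 H" and ?O = "{x \<in> nonzeros H. odd x}"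
  \<comment> \<open>At least one end is even, which is the complement of both ends being
    odd.\<close>
  have "edge_div n H 2 \<subseteq> tuple_box n ?N ?E ?N - tuple_box n ?O ?E ?O"
    using assms by (auto simp: edge_div_def mem_tuple_box_iff multiples_def)
  then have "card (edge_div n H 2) \<le> card (tuple_box n ?N ?E ?N - tuple_box n ?O ?E ?O)"
    by (intro card_mono) (auto simp: finite_tuple_box)
  also have "\<dots> = card (tuple_box n ?N ?E ?N) - card (tuple_box n ?O ?E ?O)"
    using assms by (intro card_Diff_subset) (auto simp: finite_tuple_box mem_tuple_box_iff)
  finally have "real (card (edge_div n H 2)) \<le> real (card (tuple_box n ?N ?E ?N) - card (tuple_box n ?O ?E ?O))"
    by (simp only: of_nat_le_iff)
  also have "\<dots> = real (card (tuple_box n ?N ?E ?N)) - real (card (tuple_box n ?O ?E ?O))"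
    using assms by (intro of_nat_diff card_mono) (auto simp: finite_tuple_box mem_tuple_box_iff)
  also have "\<dots> = real (card ?E) ^ (n - 1) * (real (card ?N) ^ 2 - real (card ?O) ^ 2)"
    using assms by (simp add: card_tuple_box power2_eq_square algebra_simps)
  \<comment> \<open>Rounding helps here: at most \<open>H\<close> of the \<open>2 * H\<close> values
    are even and at least \<open>H\<close> are odd. The factor 3 is 4 - 1.\<close>
  also have "\<dots> \<le> real H ^ (n - 1) * ((2 * real H) ^ 2 - real H ^ 2)"
  proof (intro mult_mono power_mono diff_mono)
    show "real (card ?E) \<le> real H" unfolding card_multiples[OF pos2] by simp
    show "real (card ?N) \<le> 2 * real H" by (simp add: card_nonzeros)
    show "real H \<le> real (card ?O)" unfolding card_odd_nonzeros by simp
    show "0 \<le> real (card ?N) ^ 2 - real (card ?O) ^ 2"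
      using card_mono[of ?N ?O] by (simp add: power_mono)
  qed auto
  also have "\<dots> = 3 * real H ^ (n + 1)"
    using assms by (simp add: power_mult_distrib power_add[symmetric] flip: power_add)
  also have "\<dots> = (2 * real H) ^ (n + 1) * (3 / 2 ^ (n + 1))"
    by (simp add: power_mult_distrib)
  finally show ?thesis .
qed

text \<open>Outside \<open>edge_div 2 H 2\<close> the middle coordinate is odd, or it is even and
  both ends are odd. To leading order this keeps the share 1/2 + 1/2 * 1/4 = 5/8, reducing
  \<open>16 * K^2 * H\<close> to \<open>10 * K^2 * H\<close> for \<open>K = H div m\<close>.\<close>

lemma card_edge_div_diff_le:
  assumes "odd m"
  shows "card (edge_div 2 H m - edge_div 2 H 2) \<le> 2 * ((H div m) * (H div m + 1)) * (5 * H + 1)"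
proof -
  let ?N = "nonzeros H" and ?M = "multiples m H" and ?O = "{x \<in> nonzeros H. odd x}"
  let ?Me = "{x \<in> multiples m H. even x}" and ?Mo = "{x \<in> multiples m H. odd x}"
  define K where "K = H div m"
  have m: "m > 0" using assms by (cases m) auto
  have *: "(\<forall>i. 0 < i \<longrightarrow> i < 2 \<longrightarrow> P i) \<longleftrightarrow> P 1" for P :: "nat \<Rightarrow> bool"
    by (auto simp: less_2_cases_iff)
  have "edge_div 2 H m - edge_div 2 H 2 \<subseteq>
    (tuple_box 2 ?M ?Mo ?N \<union> tuple_box 2 ?Mo ?Me ?O) \<union> (tuple_box 2 ?N ?Mo ?M \<union> tuple_box 2 ?O ?Me ?Mo)"
    by (auto simp: edge_div_def mem_tuple_box_iff * multiples_def)
  then have "card (edge_div 2 H m - edge_div 2 H 2) \<le>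
    card ((tuple_box 2 ?M ?Mo ?N \<union> tuple_box 2 ?Mo ?Me ?O) \<union> (tuple_box 2 ?N ?Mo ?M \<union> tuple_box 2 ?O ?Me ?Mo))"
    by (intro card_mono) (auto simp: finite_tuple_box)
  also have "\<dots> \<le> (card (tuple_box 2 ?M ?Mo ?N) + card (tuple_box 2 ?Mo ?Me ?O)) +
      (card (tuple_box 2 ?N ?Mo ?M) + card (tuple_box 2 ?O ?Me ?Mo))"
    by (rule order_trans[OF card_Un_le add_mono[OF card_Un_le card_Un_le]])
  also have "\<dots> = 2 * (card ?M * card ?Mo * card ?N + card ?Me * card ?Mo * card ?O)"
    by (simp add: card_tuple_box)
  also have "\<dots> \<le> 2 * ((2 * K) * (K + 1) * (2 * H) + K * (K + 1) * (H + 1))"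
    unfolding card_multiples[OF m] card_multiples_parity[OF assms] card_nonzeros card_odd_nonzeros
      K_def[symmetric]
    by (intro mult_le_mono add_le_mono order_refl) presburger+
  also have "\<dots> = 2 * (K * (K + 1)) * (5 * H + 1)" by (simp add: algebra_simps)
  finally show ?thesis by (simp add: K_def)
qed

lemma dumas_tuple_in_edge_div:
  assumes n: "n \<ge> 2" and x: "x \<in> PiE {..n} (\<lambda>_. nonzeros H)" and p: "prime p"
    and dvd: "\<And>i. 0 < i \<Longrightarrow> i < n \<Longrightarrow> int p dvd x i" "int p dvd x 0 \<or> int p dvd x n"
  shows "x \<in> edge_div n H 2 \<union> (\<Union>j<H. edge_div n H (2 * j + 3))"
proof -
  have "x \<in> edge_div n H p"
    using n x dvd by (auto simp: edge_div_def mem_tuple_box_iff multiples_def PiE_iff)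
  moreover have "p = 2 \<or> (\<exists>j<H. p = 2 * j + 3)"
  proof (cases "p = 2")
    case False
    then have "p > 2" using prime_ge_2_nat[OF p] by simp
    then have "odd p" using p prime_odd_nat by blast
    then obtain k where k: "p = 2 * k + 1" by (elim oddE)
    \<comment> \<open>Since \<open>n >= 2\<close>, index 1 is an inner index, so \<open>p\<close>
      divides the nonzero number \<open>x 1\<close>; this bounds \<open>p\<close> and hence the
      range of \<open>j\<close>.\<close>
    have "x 1 \<in> nonzeros H" using x n by auto
    then have "int p \<le> int H"
      using dvd(1)[of 1] n dvd_imp_le_int[of "x 1" "int p"] by (auto simp: nonzeros_def)
    then have "p = 2 * (k - 1) + 3" "k - 1 < H" using k \<open>p > 2\<close> by auto
    then show ?thesis by blast
  qed simp
  ultimately show ?thesis by blast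
qed

section \<open>From Dumas polynomials to coefficient tuples\<close>

lemma abs_coeff_le_height: "\<bar>coeff f i\<bar> \<le> height f"
proof (cases "i \<le> degree f")
  case True
  then show ?thesis unfolding height_def by (intro Max_ge) auto
next
  case False
  have "\<bar>coeff f 0\<bar> \<le> height f" unfolding height_def by (intro Max_ge) auto
  with False show ?thesis by (simp add: coeff_eq_0)
qed

text \<open>Polynomials of degree \<open>n\<close> inject into tuples. Those with a zero coordinate
  are covered by the \<open>n + 1\<close> sets \<open>Z i\<close>, which gives the first summand;
  the others are covered by the sets \<open>edge_div\<close>.\<close>

lemma dumas_count_le:
  assumes n: "n \<ge> 2"
  shows "dumas_count n H \<le> (n + 1) * (2 * H + 1) ^ n +
    card (edge_div n H 2 \<union> (\<Union>j<H. edge_div n H (2 * j + 3)))"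
proof -
  define D where "D = {f :: int poly. degree f = n \<and> dumas_poly f \<and> height f \<le> int H}"
  define c where "c f = restrict (coeff f) {..n}" for f :: "int poly"
  define Z :: "nat \<Rightarrow> (nat \<Rightarrow> int) set" where
    "Z i = PiE {..n} (\<lambda>j. if j = i then {0} else {- int H..int H})" for i
  have inj: "inj_on c D"
  proof (rule inj_onI)
    fix f g assume fg: "f \<in> D" "g \<in> D" "c f = c g"
    show "f = g"
    proof (rule poly_eqI)
      fix i
      have "c f i = c g i" using fg by simp
      then show "coeff f i = coeff g i"
        using fg by (cases "i \<le> n") (auto simp: c_def D_def coeff_eq_0)
    qed
  qed
  have sub: "c f \<in> (\<Union>i\<le>n. Z i) \<union> (edge_div n H 2 \<union> (\<Union>j<H. edge_div n H (2 * j + 3)))"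
    if f: "f \<in> D" for f
  proof (cases "\<exists>i\<le>n. coeff f i = 0")
    case True
    have "\<bar>coeff f j\<bar> \<le> int H" for j
      using f abs_coeff_le_height[of f j] by (simp add: D_def)
    then have "- int H \<le> coeff f j \<and> coeff f j \<le> int H" for j
      by (metis abs_le_iff minus_le_iff)
    with True show ?thesis by (auto simp: Z_def c_def PiE_iff)
  next
    case False
    obtain p where p: "prime p" "\<And>i. 0 < i \<Longrightarrow> i < n \<Longrightarrow> int p dvd coeff f i"
      "int p dvd coeff f 0 \<or> int p dvd coeff f n"
      using dumas_poly_imp_common_prime[of f] f n by (auto simp: D_def)
    have "c f \<in> PiE {..n} (\<lambda>_. nonzeros H)"
      using False f order_trans[OF abs_coeff_le_height, of f "int H"]
      by (auto simp: c_def nonzeros_def D_def)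
    from dumas_tuple_in_edge_div[OF n this p(1)] p(2,3) show ?thesis
      by (simp add: c_def)
  qed
  have cZ: "card (Z i) = (2 * H + 1) ^ n" if "i \<le> n" for i
  proof -
    have eq: "{..n} = insert i ({..n} - {i})" using that by auto
    have "(\<Prod>j\<in>{..n} - {i}. card (if j = i then {0} else {- int H..int H})) = (2 * H + 1) ^ n"
      using that by (subst prod.cong[OF refl, where h = "\<lambda>_. 2 * H + 1"]) auto
    then show ?thesis unfolding Z_def
      by (subst card_PiE, simp, subst eq, subst prod.insert) auto
  qed
  have fZ: "finite (Z i)" for i unfolding Z_def by (rule finite_PiE) auto
  have "card D = card (c ` D)" using inj by (simp add: card_image)
  also have "\<dots> \<le> card ((\<Union>i\<le>n. Z i) \<union> (edge_div n H 2 \<union> (\<Union>j<H. edge_div n H (2 * j + 3))))"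
    using sub by (intro card_mono) (auto simp: fZ finite_edge_div)
  also have "\<dots> \<le> card (\<Union>i\<le>n. Z i) + card (edge_div n H 2 \<union> (\<Union>j<H. edge_div n H (2 * j + 3)))"
    by (rule card_Un_le)
  also have "card (\<Union>i\<le>n. Z i) \<le> (\<Sum>i\<le>n. card (Z i))" by (rule card_UN_le) simp
  also have "\<dots> = (n + 1) * (2 * H + 1) ^ n" by (simp add: cZ)
  finally show ?thesis by (simp add: D_def dumas_count_def)
qed

section \<open>Assembling the bounds\<close>

lemma dumas_count_le_of_ge_3:
  assumes n: "n \<ge> 3"
  shows "real (dumas_count n H) \<le>
    (2 * real H) ^ (n + 1) * tau n + real (n + 1) * (2 * real H + 1) ^ n"
proof -
  let ?U = "edge_div n H 2 \<union> (\<Union>j<H. edge_div n H (2 * j + 3))"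
  have "card ?U \<le> card (edge_div n H 2) + (\<Sum>j<H. card (edge_div n H (2 * j + 3)))"
    by (intro order_trans[OF card_Un_le] add_left_mono card_UN_le) simp
  then have "real (card ?U) \<le> real (card (edge_div n H 2) + (\<Sum>j<H. card (edge_div n H (2 * j + 3))))"
    by (simp only: of_nat_le_iff)
  also have "\<dots> \<le> (2 * real H) ^ (n + 1) * (3 / 2 ^ (n + 1)) +
      (\<Sum>j<H. (2 * real H) ^ (n + 1) * (2 / real (2 * j + 3) ^ n))"
    unfolding of_nat_add[of "card (edge_div n H 2)"] of_nat_sum
    by (intro add_mono sum_mono card_edge_div_2_le card_edge_div_le) (use n in linarith)+
  also have "\<dots> = (2 * real H) ^ (n + 1) *
      (3 / 2 ^ (n + 1) + 2 * (\<Sum>j<H. 1 / real (2 * j + 3) ^ n))"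
    by (simp add: sum_distrib_left distrib_left mult_ac)
  also have "\<dots> \<le> (2 * real H) ^ (n + 1) *
      (3 / 2 ^ (n + 1) + 2 * (1 / 3 ^ n + 1 / (8 * 5 ^ (n - 2))))"
    using n by (intro mult_left_mono add_left_mono sum_odd_inverse_powers_le) auto
  also have "\<dots> \<le> (2 * real H) ^ (n + 1) * tau n"
    by (intro mult_left_mono union_bound_le_tau n) simp
  finally have "real (card ?U) \<le> (2 * real H) ^ (n + 1) * tau n" .
  moreover have "real (dumas_count n H) \<le> real ((n + 1) * (2 * H + 1) ^ n + card ?U)"
    using dumas_count_le[of n H] n by (simp only: of_nat_le_iff)
  ultimately show ?thesis by (simp add: algebra_simps)
qed

lemma dumas_count_2_le:
  assumes H: "H \<ge> 1"
  shows "real (dumas_count 2 H) \<le> (2 * real H) ^ 3 * tau 2 + 200 * real H ^ 2"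
proof -
  let ?h = "real H"
  let ?A = "edge_div 2 H 2" and ?B = "\<lambda>j. edge_div 2 H (2 * j + 3)"
  have h1: "?h \<ge> 1" using H by simp
  \<comment> \<open>Tuples already counted for 2 are removed from the odd sets, so that the factor
    5/8 applies.\<close>
  have "?A \<union> (\<Union>j<H. ?B j) = ?A \<union> (\<Union>j<H. ?B j - ?A)" by blast
  then have "card (?A \<union> (\<Union>j<H. ?B j)) \<le> card ?A + (\<Sum>j<H. card (?B j - ?A))"
    by (simp only:) (intro order_trans[OF card_Un_le] add_left_mono card_UN_le, simp)
  then have "real (card (?A \<union> (\<Union>j<H. ?B j))) \<le> real (card ?A + (\<Sum>j<H. card (?B j - ?A)))"
    by (simp only: of_nat_le_iff)
  also have "\<dots> = real (card ?A) + (\<Sum>j<H. real (card (?B j - ?A)))" by simp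
  also have "\<dots> \<le> 3 * ?h ^ 3 + (\<Sum>j<H. 2 * (5 * ?h + 1) * (33 / 32 * ?h ^ 2 * (1 / real (2 * j + 3) ^ 2) + 8))"
  proof (intro add_mono sum_mono)
    show "real (card ?A) \<le> 3 * ?h ^ 3"
      using card_edge_div_2_le[of 2 H] by (simp add: power_mult_distrib)
    fix j
    define K where "K = H div (2 * j + 3)"
    have "real K \<le> ?h / real (2 * j + 3)" unfolding K_def by (rule of_nat_div_le_of_nat)
    then have K2: "real K ^ 2 \<le> (?h / real (2 * j + 3)) ^ 2" by (intro power_mono) auto
    \<comment> \<open>AM-GM: \<open>K \<le> K\<^sup>2 / 32 + 8\<close>, so that summing over \<open>j\<close> costs \<open>O(H)\<close> instead of \<open>O(H log H)\<close>\<close>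
    have "0 \<le> (real K - 16) ^ 2" by simp
    then have "real K * (real K + 1) \<le> 33 / 32 * real K ^ 2 + 8"
      by (simp add: power2_eq_square algebra_simps)
    also have "\<dots> \<le> 33 / 32 * (?h / real (2 * j + 3)) ^ 2 + 8" using K2 by simp
    also have "\<dots> = 33 / 32 * ?h ^ 2 * (1 / real (2 * j + 3) ^ 2) + 8" by (simp add: power_divide)
    finally have le: "real K * (real K + 1) \<le> 33 / 32 * ?h ^ 2 * (1 / real (2 * j + 3) ^ 2) + 8" .
    have "real (card (?B j - ?A)) \<le> real (2 * (K * (K + 1)) * (5 * H + 1))"
      unfolding K_def of_nat_le_iff by (rule card_edge_div_diff_le) simp
    also have "\<dots> = 2 * (5 * ?h + 1) * (real K * (real K + 1))" by (simp add: algebra_simps)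
    also have "\<dots> \<le> 2 * (5 * ?h + 1) * (33 / 32 * ?h ^ 2 * (1 / real (2 * j + 3) ^ 2) + 8)"
      by (intro mult_left_mono le) simp
    finally show "real (card (?B j - ?A)) \<le> \<dots>" .
  qed
  also have "\<dots> = 3 * ?h ^ 3 + 2 * (5 * ?h + 1) *
      (33 / 32 * ?h ^ 2 * (\<Sum>j<H. 1 / real (2 * j + 3) ^ 2) + 8 * ?h)"
    by (simp only: sum_distrib_left[symmetric] sum.distrib) simp
  \<comment> \<open>The constant 17/72 is 1/9 + 1/8.\<close>
  also have "\<dots> \<le> 3 * ?h ^ 3 + 2 * (5 * ?h + 1) * (33 / 32 * ?h ^ 2 * (17 / 72) + 8 * ?h)"
    using sum_odd_inverse_powers_le[of 2 H]
    by (intro add_left_mono mult_left_mono add_right_mono) auto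
  finally have U: "real (card (?A \<union> (\<Union>j<H. ?B j))) \<le>
    3 * ?h ^ 3 + 2 * (5 * ?h + 1) * (33 / 32 * ?h ^ 2 * (17 / 72) + 8 * ?h)" .
  have "real (dumas_count 2 H) \<le> real (3 * (2 * H + 1) ^ 2 + card (?A \<union> (\<Union>j<H. ?B j)))"
    using dumas_count_le[of 2 H] by (simp only: of_nat_le_iff) simp
  also have "\<dots> \<le> 3 * (2 * ?h + 1) ^ 2 +
      (3 * ?h ^ 3 + 2 * (5 * ?h + 1) * (33 / 32 * ?h ^ 2 * (17 / 72) + 8 * ?h))"
    using U by (simp add: add.commute)
  \<comment> \<open>Expanding gives the cubic coefficient \<open>3 + 935 / 384\<close>, about 5.435,
    just below \<open>8 * (343 / 500) = 5.488\<close>. The lower terms have coefficients with sum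
    below 124, so 200 covers them.\<close>
  also have "\<dots> \<le> 8 * (343 / 500) * ?h ^ 3 + 200 * ?h ^ 2"
  proof -
    have "(3 + 935 / 384) * v + (92 + 187 / 384) * u + 28 * x + 3
        \<le> 8 * (343 / 500) * v + 200 * u"
      if "x \<le> u" "1 \<le> u" "0 \<le> v" for x u v :: real
      using that by simp
    moreover have "?h \<le> ?h ^ 2" "1 \<le> ?h ^ 2" "0 \<le> ?h ^ 3"
      using h1 by (simp_all add: self_le_power)
    ultimately have le: "(3 + 935 / 384) * ?h ^ 3 + (92 + 187 / 384) * ?h ^ 2 + 28 * ?h + 3
        \<le> 8 * (343 / 500) * ?h ^ 3 + 200 * ?h ^ 2"
      by blast
    have "3 * (2 * ?h + 1) ^ 2 +
        (3 * ?h ^ 3 + 2 * (5 * ?h + 1) * (33 / 32 * ?h ^ 2 * (17 / 72) + 8 * ?h)) =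
      (3 + 935 / 384) * ?h ^ 3 + (92 + 187 / 384) * ?h ^ 2 + 28 * ?h + 3"
      by (simp add: power2_eq_square power3_eq_cube algebra_simps add_divide_distrib)
    then show ?thesis using le by (simp only:)
  qed
  also have "\<dots> \<le> (2 * ?h) ^ 3 * tau 2 + 200 * ?h ^ 2"
    using mult_left_mono[OF tau_2_ge, of "8 * ?h ^ 3"] by (simp add: power_mult_distrib mult_ac)
  finally show ?thesis .
qed

theorem theorem1:
  fixes n :: nat
  assumes "n \<ge> 2"
  shows "\<exists>E :: nat \<Rightarrow> real.
    E \<in> O(\<lambda>H. if n = 2 then real H ^ 2 * (ln (real H)) ^ 2 else real H ^ n) \<and>
    (\<forall>H\<ge>1. real (dumas_count n H) \<le> (2 * real H) ^ (n + 1) * tau n + E H)"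
proof (cases "n = 2")
  case True
  have "(\<lambda>H. 200 * real H ^ 2) \<in> O(\<lambda>H. real H ^ 2 * (ln (real H)) ^ 2)"
  proof (rule bigoI[where c = 200], rule eventually_mono[OF eventually_ge_at_top[of 3]])
    \<comment> \<open>The threshold 3 exceeds e, so the logarithm is at least 1 and its square can
      be inserted.\<close>
    fix H :: nat assume "H \<ge> 3"
    then have "exp 1 \<le> real H" using exp_le by linarith
    then have "1 \<le> ln (real H)" using \<open>H \<ge> 3\<close> by (simp add: ln_ge_iff)
    then have "real H ^ 2 * 1 \<le> real H ^ 2 * ln (real H) ^ 2" by (intro mult_left_mono) auto
    then show "norm (200 * real H ^ 2) \<le> 200 * norm (real H ^ 2 * (ln (real H)) ^ 2)"
      by simp
  qed
  then show ?thesis using True dumas_count_2_le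
    by (intro exI[of _ "\<lambda>H. 200 * real H ^ 2"]) (simp add: numeral_3_eq_3)
next
  case False
  then have n: "n \<ge> 3" using assms by simp
  have "(\<lambda>H. real (n + 1) * (2 * real H + 1) ^ n) \<in> O(\<lambda>H. real H ^ n)"
  proof (rule bigoI[where c = "real (n + 1) * 3 ^ n"], rule eventually_mono[OF eventually_ge_at_top[of 1]])
    fix H :: nat assume "H \<ge> 1"
    \<comment> \<open>For \<open>H >= 1\<close>, \<open>2 * H + 1 <= 3 * H\<close>; this is the
      origin of the constant \<open>3 ^ n\<close>.\<close>
    then have "(2 * real H + 1) ^ n \<le> (3 * real H) ^ n" by (intro power_mono) auto
    then show "norm (real (n + 1) * (2 * real H + 1) ^ n) \<le> real (n + 1) * 3 ^ n * norm (real H ^ n)"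
      by (simp add: abs_mult power_mult_distrib mult.assoc mult_left_mono)
  qed
  with False show ?thesis using dumas_count_le_of_ge_3[OF n]
    by (intro exI[of _ "\<lambda>H. real (n + 1) * (2 * real H + 1) ^ n"]) simp
qed

end
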